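(* $\mathfrak n_{\dim}((\mathbb N,<))=\mathfrak n_{\dim}((\mathbb Z,<))=0$; that is, neither $(\mathbb N,<)$ nor $(\mathbb Z,<)$ admits a dimension function.
   Context: "Definable" means definable in the structure with parameters; $\mathbb N$ is the set of nonnegative integers. Let $\mathcal M=(M,\ldots)$ be a structure, $\mathrm{Def}_n(\mathcal M)$ the collection of definable subsets of $M^n$, and $\mathrm{Def}(\mathcal M)=\bigcup_{n>0}\mathrm{Def}_n(\mathcal M)$. Let $\Pi:M^n\to M^{n-1}$ be the projection forgetting the last coordinate, and for $X\subseteq M^n$, $x\in\Pi(X)$, put $X_x^{\Pi}=\{y\in M: (x,y)\in X\}$. Convention: $-\infty+i=-\infty$. A *dimension function* on $\mathcal M$ is a function $\dim:\mathrm{Def}(\mathcal M)\to\mathbb N\cup\{-\infty\}$ such that for every $n>0$: (1) $\dim(\emptyset)=-\infty$, $\dim(\{a\})=0$ for each $a\in M$, and $\dim(M)=1$; $(2)_n$ $\dim(X\cup Y)=\max\{\dim X,\dim Y\}$ for $X,Y\in\mathrm{Def}_n(\mathcal M)$; $(3)_n$ $\dim X=\dim X^{\sigma}$ for each $X\in\mathrm{Def}_n(\mathcal M)$ and each permutation $\sigma$ of $\{1,\dots,n\}$, where $X^\sigma=\{(x_{\sigma(1)},\dots,x_{\sigma(n)}):(x_1,\dots,x_n)\in X\}$; $(4)_n$ if $n>1$ and $X\in\mathrm{Def}_n(\mathcal M)$, then for $i=0,1$ the set $X(i)=\{x\in\Pi(X):\dim X_x^{\Pi}=i\}$ belongs to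 $\mathrm{Def}_{n-1}(\mathcal M)$ and $\dim(X\cap\Pi^{-1}(X(i)))=\dim(X(i))+i$. $\mathfrak n_{\dim}(\mathcal M)$ is the cardinality of the set of dimension functions on $\mathcal M$. *)

theory Defs
  imports
    "HOL-Library.Extended"
    "HOL-Library.FuncSet"
    "HOL-Combinatorics.Permutations"
begin

unbundle cardinal_syntax

text \<open>
  The universe of a structure is the whole type \<open>'a\<close>. The arity maps delimit the language: a
  symbol that is mapped to \<open>None\<close> does not belong to it.
\<close>

record ('f, 'r, 'a) struct =
  fun_arity :: "'f \<Rightarrow> nat option"
  rel_arity :: "'r \<Rightarrow> nat option"
  fun_interp :: "'f \<Rightarrow> 'a list \<Rightarrow> 'a"
  rel_interp :: "'r \<Rightarrow> 'a list \<Rightarrow> bool"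

datatype 'f fo_term = Var nat | App 'f "'f fo_term list"

datatype ('f, 'r) fo_formula =
    Eq "'f fo_term" "'f fo_term"
  | Rel 'r "'f fo_term list"
  | Neg "('f, 'r) fo_formula"
  | Conj "('f, 'r) fo_formula" "('f, 'r) fo_formula"
  | Ex nat "('f, 'r) fo_formula"

fun wf_term :: "('f, 'r, 'a) struct \<Rightarrow> 'f fo_term \<Rightarrow> bool" where
  "wf_term M (Var i) \<longleftrightarrow> True"
| "wf_term M (App f ts) \<longleftrightarrow> fun_arity M f = Some (length ts) \<and> list_all (wf_term M) ts"

primrec wf_formula :: "('f, 'r, 'a) struct \<Rightarrow> ('f, 'r) fo_formula \<Rightarrow> bool" where
  "wf_formula M (Eq s t) \<longleftrightarrow> wf_term M s \<and> wf_term M t"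
| "wf_formula M (Rel r ts) \<longleftrightarrow> rel_arity M r = Some (length ts) \<and> list_all (wf_term M) ts"
| "wf_formula M (Neg \<phi>) \<longleftrightarrow> wf_formula M \<phi>"
| "wf_formula M (Conj \<phi> \<psi>) \<longleftrightarrow> wf_formula M \<phi> \<and> wf_formula M \<psi>"
| "wf_formula M (Ex i \<phi>) \<longleftrightarrow> wf_formula M \<phi>"

primrec term_val :: "('f, 'r, 'a) struct \<Rightarrow> (nat \<Rightarrow> 'a) \<Rightarrow> 'f fo_term \<Rightarrow> 'a" where
  "term_val M e (Var i) = e i"
| "term_val M e (App f ts) = fun_interp M f (map (term_val M e) ts)"

primrec sat :: "('f, 'r, 'a) struct \<Rightarrow> (nat \<Rightarrow> 'a) \<Rightarrow> ('f, 'r) fo_formula \<Rightarrow> bool" where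
  "sat M e (Eq s t) \<longleftrightarrow> term_val M e s = term_val M e t"
| "sat M e (Rel r ts) \<longleftrightarrow> rel_interp M r (map (term_val M e) ts)"
| "sat M e (Neg \<phi>) \<longleftrightarrow> \<not> sat M e \<phi>"
| "sat M e (Conj \<phi> \<psi>) \<longleftrightarrow> sat M e \<phi> \<and> sat M e \<psi>"
| "sat M e (Ex i \<phi>) \<longleftrightarrow> (\<exists>a. sat M (e(i := a)) \<phi>)"

text \<open>
  The Cartesian power \<open>M\<^sup>n\<close> is the set of lists of length \<open>n\<close>; in particular \<open>M\<close> itself, viewed as
  \<open>M\<^sup>1\<close>, consists of the one-element lists. Definability is with parameters: the variables with
  index below \<open>n\<close> stand for the coordinates, and all other variables that occur free in the
  formula (finitely many) are assigned parameters by \<open>p\<close>.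
\<close>

definition Def_n :: "('f, 'r, 'a) struct \<Rightarrow> nat \<Rightarrow> 'a list set set" where
  "Def_n M n = {X. \<exists>\<phi> p. wf_formula M \<phi> \<and>
     X = {xs. length xs = n \<and> sat M (\<lambda>i. if i < n then xs ! i else p i) \<phi>}}"

definition Def :: "('f, 'r, 'a) struct \<Rightarrow> 'a list set set" where
  "Def M = (\<Union>n\<in>{0<..}. Def_n M n)"

definition fibre :: "'a list set \<Rightarrow> 'a list \<Rightarrow> 'a list set" where
  "fibre X x = {[y] | y. x @ [y] \<in> X}"

definition fibre_dim_set ::
  "('a list set \<Rightarrow> nat extended) \<Rightarrow> 'a list set \<Rightarrow> nat \<Rightarrow> 'a list set" where
  "fibre_dim_set d X i = {x \<in> butlast ` X. d (fibre X x) = Fin i}"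

text \<open>
  \<open>\<nat> \<union> {-\<infinity>}\<close> is the part of \<^typ>\<open>nat extended\<close> without \<^const>\<open>Pinf\<close>. Using the extensional function
  space makes a dimension function depend only on its values on \<^term>\<open>Def M\<close>, so that distinct
  elements of \<open>dimension_functions M\<close> are distinct functions on \<^term>\<open>Def M\<close>. Coordinates are numbered
  from \<open>0\<close>.
\<close>

definition dimension_function ::
  "('f, 'r, 'a) struct \<Rightarrow> ('a list set \<Rightarrow> nat extended) \<Rightarrow> bool" where
  "dimension_function M d \<longleftrightarrow>
     d \<in> Def M \<rightarrow>\<^sub>E (range Fin \<union> {Minf}) \<and>
     d {} = Minf \<and> (\<forall>a. d {[a]} = Fin 0) \<and> d {xs. length xs = 1} = Fin 1 \<and>
     (\<forall>n>0.
       (\<forall>X\<in>Def_n M n. \<forall>Y\<in>Def_n M n. d (X \<union> Y) = max (d X) (d Y)) \<and>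
       (\<forall>X\<in>Def_n M n. \<forall>\<sigma>. \<sigma> permutes {..<n} \<longrightarrow> d (permute_list \<sigma> ` X) = d X) \<and>
       (n > 1 \<longrightarrow> (\<forall>X\<in>Def_n M n. \<forall>i\<in>{0, 1}.
          fibre_dim_set d X i \<in> Def_n M (n - 1) \<and>
          d (X \<inter> butlast -` fibre_dim_set d X i) = d (fibre_dim_set d X i) + Fin i)))"

definition dimension_functions ::
  "('f, 'r, 'a) struct \<Rightarrow> ('a list set \<Rightarrow> nat extended) set" where
  "dimension_functions M = {d. dimension_function M d}"

text \<open>
  The number of dimension functions may be infinite, hence it is taken as a cardinal (in the sense
  of \<^const>\<open>card_of\<close>) and not by means of \<^const>\<open>card\<close>.
\<close>

definition n_dim :: "('f, 'r, 'a) struct \<Rightarrow> ('a list set \<Rightarrow> nat extended) rel" where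
  "n_dim M = |dimension_functions M|"

definition order_struct :: "(unit, unit, 'a::ord) struct" where
  "order_struct = \<lparr>
     fun_arity = \<lambda>_. None,
     rel_arity = \<lambda>_. Some 2,
     fun_interp = \<lambda>_ _. undefined,
     rel_interp = \<lambda>_ xs. xs ! 0 < xs ! 1\<rparr>"

end

theory Submission
  imports Defs
begin

text \<open>
  Suppose all rays \<open>{y. R x y}\<close> have dimension 1, where \<open>R\<close> is \<open><\<close> or \<open>>\<close>, and let
  \<open>B = {(x, y). R x y}\<close>, so \<open>dim B = 2\<close>. The set of all \<open>(x, z, y)\<close> with \<open>R x z\<close> and \<open>R z y\<close> has
  rays as fibres over \<open>B\<close>, hence dimension \<open>dim B + 1\<close>. After exchanging \<open>y\<close> and \<open>z\<close> its fibres are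
  bounded intervals, which are finite, so its dimension is at most \<open>dim B\<close>, a contradiction.
  In \<open>\<nat>\<close> all upper rays are cofinite, hence of dimension 1. In \<open>\<int>\<close> two upper rays differ by a finite
  set, likewise two lower rays, and at least one of the two kinds has dimension 1.
\<close>

section \<open>Definability of finite sets and of the universe\<close>

primrec finite_formula :: "nat \<Rightarrow> ('f, 'r) fo_formula" where
  "finite_formula 0 = Neg (Eq (Var 0) (Var 0))"
| "finite_formula (Suc k) = Neg (Conj (Neg (finite_formula k)) (Neg (Eq (Var 0) (Var (Suc k)))))"

lemma wf_finite_formula: "wf_formula M (finite_formula k)"
  by (induction k) auto

lemma sat_finite_formula: "sat M e (finite_formula k) \<longleftrightarrow> (\<exists>i<k. e 0 = e (Suc i))"
  by (induction k) (auto simp: less_Suc_eq)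

lemma Def_nI:
  assumes "wf_formula M \<phi>"
    and "\<And>xs. xs \<in> X \<longleftrightarrow> length xs = n \<and> sat M (\<lambda>i. if i < n then xs ! i else p i) \<phi>"
  shows "X \<in> Def_n M n"
  using assms unfolding Def_n_def by blast

lemma finite_in_Def_1:
  assumes "finite A"
  shows "(\<lambda>a. [a]) ` A \<in> Def_n M 1"
proof -
  obtain as where as: "set as = A" using assms finite_list by blast
  show ?thesis
  \<comment> \<open>Variable 0 is the coordinate, so the entry \<open>as ! i\<close> is the value of
    the parameter variable \<open>Suc i\<close>; this is the reason for the shift in
    \<open>p\<close>.\<close>
  proof (rule Def_nI[where \<phi> = "finite_formula (length as)" and p = "\<lambda>i. as ! (i - 1)"])
    show "wf_formula M (finite_formula (length as))" by (rule wf_finite_formula)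
    show "xs \<in> (\<lambda>a. [a]) ` A \<longleftrightarrow> length xs = 1 \<and>
        sat M (\<lambda>i. if i < 1 then xs ! i else as ! (i - 1)) (finite_formula (length as))" for xs
      unfolding as[symmetric]
      by (cases xs) (auto simp: sat_finite_formula in_set_conv_nth image_iff)
  qed
qed

lemma UNIV_in_Def_1: "{xs. length xs = 1} \<in> Def_n M 1"
  by (rule Def_nI[where \<phi> = "Eq (Var 0) (Var 0)"]) auto

section \<open>Consequences of the axioms for an arbitrary structure\<close>

context
  fixes M :: "('f, 'r, 'a) struct" and d
  assumes dim: "dimension_function M d"
begin

lemma dim_empty: "d {} = Minf"
  using dim unfolding dimension_function_def by blast

lemma dim_singleton: "d {[a]} = Fin 0"
  using dim unfolding dimension_function_def by blast

lemma dim_UNIV: "d {xs. length xs = 1} = Fin 1"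
  using dim unfolding dimension_function_def by blast

lemma dim_Un:
  assumes "n > 0" "X \<in> Def_n M n" "Y \<in> Def_n M n"
  shows "d (X \<union> Y) = max (d X) (d Y)"
  using dim assms unfolding dimension_function_def by blast

lemma dim_permute:
  assumes "n > 0" "X \<in> Def_n M n" "\<sigma> permutes {..<n}"
  shows "d (permute_list \<sigma> ` X) = d X"
  using dim assms unfolding dimension_function_def by blast

lemma dim_fibres:
  assumes "n > 1" "X \<in> Def_n M n" "i \<in> {0, 1}"
  shows "fibre_dim_set d X i \<in> Def_n M (n - 1) \<and>
    d (X \<inter> butlast -` fibre_dim_set d X i) = d (fibre_dim_set d X i) + Fin i"
  using dim assms unfolding dimension_function_def by (meson less_trans zero_less_one)

text \<open>When all fibres have the same dimension \<open>i\<close>, the set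
  \<open>fibre_dim_set d X i\<close> is the whole projection, so axiom (4) turns into additivity. It
  also yields definability of the projection.\<close>

lemma dim_fibres_const:
  assumes "n > 1" "X \<in> Def_n M n" "i \<in> {0, 1}"
    and "\<And>x. x \<in> butlast ` X \<Longrightarrow> d (fibre X x) = Fin i"
  shows "butlast ` X \<in> Def_n M (n - 1)" and "d X = d (butlast ` X) + Fin i"
proof -
  have "fibre_dim_set d X i = butlast ` X"
    using assms(4) by (auto simp: fibre_dim_set_def)
  moreover have "X \<inter> butlast -` butlast ` X = X" by auto
  ultimately show "butlast ` X \<in> Def_n M (n - 1)" "d X = d (butlast ` X) + Fin i"
    using dim_fibres[OF assms(1-3)] by auto
qed

lemma dim_mono:
  assumes "n > 0" "X \<in> Def_n M n" "Y \<in> Def_n M n" "X \<subseteq> Y"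
  shows "d X \<le> d Y"
  using dim_Un[OF assms(1-3)] assms(4) by (metis Un_absorb1 max.cobounded1)

lemma dim_finite:
  assumes "finite A" "A \<noteq> {}"
  shows "d ((\<lambda>a. [a]) ` A) = Fin 0"
  using assms
proof (induction rule: finite_ne_induct)
  case (singleton a)
  then show ?case by (simp add: dim_singleton)
next
  case (insert a A)
  have "d ((\<lambda>a. [a]) ` {a} \<union> (\<lambda>a. [a]) ` A) = max (d ((\<lambda>a. [a]) ` {a})) (d ((\<lambda>a. [a]) ` A))"
    by (intro dim_Un[OF zero_less_one] finite_in_Def_1) (simp_all add: insert.hyps)
  then show ?case
    using insert.IH by (simp add: dim_singleton)
qed

text \<open>By monotonicity \<open>C\<close> has dimension at least 1, and its finite part
  contributes at most 0, so the maximum comes from \<open>B\<close>. This transfers dimension 1 from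
  \<open>A\<close> to a ray \<open>B\<close> through a common superset \<open>C\<close>.\<close>

lemma dim_one_diff_finite:
  assumes "A \<in> Def_n M 1" "B \<in> Def_n M 1" "C \<in> Def_n M 1" "finite F"
    and "A \<subseteq> C" "C = B \<union> (\<lambda>a. [a]) ` F" "d A = Fin 1"
  shows "d B = Fin 1"
proof (rule antisym)
  have "d ((\<lambda>a. [a]) ` F) \<le> Fin 0"
    using dim_finite[OF assms(4)] by (cases "F = {}") (simp_all add: dim_empty)
  moreover have "Fin 1 \<le> d C"
    using dim_mono[OF zero_less_one assms(1,3,5)] assms(7) by simp
  then have "Fin 1 \<le> max (d B) (d ((\<lambda>a. [a]) ` F))"
    unfolding assms(6) dim_Un[OF zero_less_one assms(2) finite_in_Def_1[OF assms(4)]] .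
  ultimately show "Fin 1 \<le> d B"
    by (auto simp: le_max_iff_disj dest: order_trans)
  show "d B \<le> Fin 1"
    unfolding dim_UNIV[symmetric] using assms(2)
    by (intro dim_mono[OF _ _ UNIV_in_Def_1]) (auto simp: Def_n_def)
qed

text \<open>Up to a swap of coordinates \<open>S\<close> and \<open>S'\<close> are one set of
  triples: ray fibres give it dimension 3, finite interval fibres at most 2. Keeping
  \<open>R\<close> abstract covers both \<open><\<close> and \<open>>\<close>.\<close>

lemma dim_rays_contradiction:
  assumes Def_B: "{[x, y] | x y. R x y} \<in> Def_n M 2"
    and Def_S: "{[x, y, z] | x y z. R x z \<and> R z y} \<in> Def_n M 3"
    and Def_S': "{[x, z, y] | x z y. R x z \<and> R z y} \<in> Def_n M 3"
    and trans: "transp R"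
    and fin: "\<And>x y. finite {z. R x z \<and> R z y}"
    and rays: "\<And>x. d {[y] | y. R x y} = Fin 1"
  shows False
proof -
  define B S S' where "B = {[x, y] | x y. R x y}"
    and "S = {[x, y, z] | x y z. R x z \<and> R z y}"
    and "S' = {[x, z, y] | x z y. R x z \<and> R z y}"
  note defs = B_def S_def S'_def
  have Defs: "B \<in> Def_n M 2" "S \<in> Def_n M 3" "S' \<in> Def_n M 3"
    using Def_B Def_S Def_S' by (simp_all add: defs)
  \<comment> \<open>An empty ray would have dimension \<open>Minf\<close> instead of
    \<open>Fin 1\<close>. Seriality makes the two projections below onto.\<close>
  have serial: "\<exists>y. R x y" for x
    using rays[of x] dim_empty by (cases "\<exists>y. R x y") auto

  have "butlast ` B = {xs. length xs = 1}"
  proof (intro set_eqI iffI)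
    fix xs :: "'a list" assume "xs \<in> {xs. length xs = 1}"
    then obtain x where "xs = [x]" by (auto simp: length_Suc_conv)
    moreover obtain y where "R x y" using serial by blast
    ultimately show "xs \<in> butlast ` B"
      by (auto simp: B_def intro!: image_eqI[of _ _ "[x, y]"])
  qed (auto simp: B_def)
  moreover have "d (fibre B xs) = Fin 1" if "xs \<in> butlast ` B" for xs
    using that rays by (auto simp: B_def fibre_def)
  ultimately have dim_B: "d B = Fin 2"
    using dim_fibres_const(2)[of 2 B 1] Defs dim_UNIV by simp

  \<comment> \<open>The far endpoint \<open>y\<close> is forgotten here; the fibre over
    \<open>[x, z]\<close> is the ray at \<open>z\<close>.\<close>
  have "butlast ` S' = B"
  proof (intro set_eqI iffI)
    fix xs assume "xs \<in> B"
    then obtain x z where "xs = [x, z]" "R x z" by (auto simp: B_def)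
    moreover obtain y where "R z y" using serial by blast
    ultimately show "xs \<in> butlast ` S'"
      by (auto simp: S'_def intro!: image_eqI[of _ _ "[x, z, y]"])
  qed (auto simp: defs)
  moreover have "d (fibre S' xs) = Fin 1" if "xs \<in> butlast ` S'" for xs
    using that rays by (auto simp: S'_def fibre_def)
  ultimately have dim_S': "d S' = Fin 3"
    using dim_fibres_const(2)[of 3 S' 1] Defs dim_B by simp

  \<comment> \<open>Over the projection of \<open>S\<close> the interval contains some
    \<open>z\<close>, so its dimension is exactly 0 and not \<open>Minf\<close>.\<close>
  have fibre_S: "d (fibre S xs) = Fin 0" if xs: "xs \<in> butlast ` S" for xs
  proof -
    obtain x y z where "xs = [x, y]" "R x z" "R z y" using xs by (auto simp: S_def)
    moreover from this have "fibre S xs = (\<lambda>a. [a]) ` {z. R x z \<and> R z y}"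
      by (auto simp: S_def fibre_def)
    ultimately show ?thesis
      using dim_finite[OF fin[of x y]] by auto
  qed
  have "d S = d (butlast ` S) + Fin 0"
    using dim_fibres_const(2)[of 3 S 0] Defs fibre_S by simp
  also have "\<dots> = d (butlast ` S)" by (cases "d (butlast ` S)") auto
  also have "\<dots> \<le> d B"
  proof (rule dim_mono[of 2])
    show "butlast ` S \<in> Def_n M 2"
      using dim_fibres_const(1)[of 3 S 0] Defs fibre_S by simp
    \<comment> \<open>Only an inclusion is claimed: a pair in \<open>B\<close> with nothing strictly
      between its entries is not in the projection.\<close>
    show "butlast ` S \<subseteq> B"
      using trans by (auto simp: defs dest: transpD)
  qed (use Defs in auto)
  finally have dim_S: "d S \<le> Fin 2" by (simp add: dim_B)

  \<comment> \<open>Coordinates are counted from 0, so this swaps the last two entries of a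
    triple.\<close>
  let ?\<sigma> = "transpose (Suc 0) 2"
  have permute: "permute_list ?\<sigma> [x, y, z] = [x, z, y]" for x y z :: 'a
    by (simp add: permute_list_def transpose_def upt_rec)
  have "permute_list ?\<sigma> ` S = S'"
  proof (intro set_eqI iffI)
    fix xs assume "xs \<in> S'"
    then obtain x y z where "xs = [x, z, y]" "R x z" "R z y" by (auto simp: S'_def)
    then show "xs \<in> permute_list ?\<sigma> ` S"
      by (auto simp: S_def permute intro!: image_eqI[of _ _ "[x, y, z]"])
  qed (auto simp: defs permute)
  moreover have "?\<sigma> permutes {..<3}" by (rule permutes_swap_id) auto
  ultimately have "d S' = d S"
    using dim_permute[of 3 S ?\<sigma>] Defs by simp
  with dim_S dim_S' show False by simp
qed

end

section \<open>Definable sets of an ordered structure\<close>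

lemma length_2_conv: "length xs = 2 \<longleftrightarrow> (\<exists>x y. xs = [x, y])"
  by (auto simp: length_Suc_conv numeral_2_eq_2)

lemma length_3_conv: "length xs = 3 \<longleftrightarrow> (\<exists>x y z. xs = [x, y, z])"
  by (auto simp: length_Suc_conv numeral_3_eq_3)

lemma wf_order_atom: "wf_formula order_struct (Rel () [Var i, Var j])"
  by (simp add: order_struct_def)

lemma sat_order_atom: "sat order_struct e (Rel () [Var i, Var j]) \<longleftrightarrow> e i < e j"
  by (simp add: order_struct_def)

lemma rays_in_Def:
  "{[y] | y. x < y} \<in> Def_n order_struct 1"
  "{[y] | y. y < x} \<in> Def_n order_struct 1"
proof -
  show "{[y] | y. x < y} \<in> Def_n order_struct 1"
    by (rule Def_nI[where \<phi> = "Rel () [Var 1, Var 0]" and p = "\<lambda>_. x"], rule wf_order_atom,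
        unfold sat_order_atom) (auto simp: length_Suc_conv)
  show "{[y] | y. y < x} \<in> Def_n order_struct 1"
    by (rule Def_nI[where \<phi> = "Rel () [Var 0, Var 1]" and p = "\<lambda>_. x"], rule wf_order_atom,
        unfold sat_order_atom) (auto simp: length_Suc_conv)
qed

lemma order_in_Def_2:
  "{[x, y] | x y. x < y} \<in> Def_n order_struct 2"
  "{[x, y] | x y. y < x} \<in> Def_n order_struct 2"
proof -
  show "{[x, y] | x y. x < y} \<in> Def_n order_struct 2"
    by (rule Def_nI[where \<phi> = "Rel () [Var 0, Var 1]"], rule wf_order_atom,
        unfold sat_order_atom) (auto simp: length_2_conv)
  show "{[x, y] | x y. y < x} \<in> Def_n order_struct 2"
    by (rule Def_nI[where \<phi> = "Rel () [Var 1, Var 0]"], rule wf_order_atom,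
        unfold sat_order_atom) (auto simp: length_2_conv)
qed

text \<open>The positions are left free so that one formula yields all four sets of triples needed
  for \<open><\<close> and \<open>>\<close>.\<close>

lemma chain_in_Def_3:
  assumes "i < 3" "j < 3" "k < 3"
  shows "{xs. length xs = 3 \<and> xs ! i < xs ! j \<and> xs ! j < xs ! k} \<in> Def_n order_struct 3"
  by (rule Def_nI[where \<phi> = "Conj (Rel () [Var i, Var j]) (Rel () [Var j, Var k])"])
    (use assms in \<open>auto simp: order_struct_def\<close>)

lemma intervals_in_Def_3:
  "{[x, y, z] | x y z. x < z \<and> z < y} \<in> Def_n order_struct 3"
  "{[x, z, y] | x z y. x < z \<and> z < y} \<in> Def_n order_struct 3"
  "{[x, y, z] | x y z. z < x \<and> y < z} \<in> Def_n order_struct 3"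
  "{[x, z, y] | x z y. z < x \<and> y < z} \<in> Def_n order_struct 3"
proof -
  show "{[x, y, z] | x y z. x < z \<and> z < y} \<in> Def_n order_struct 3"
    by (rule back_subst[where P = "\<lambda>X. X \<in> Def_n order_struct 3", OF chain_in_Def_3[of 0 2 1]])
      (auto simp: length_3_conv)
  show "{[x, z, y] | x z y. x < z \<and> z < y} \<in> Def_n order_struct 3"
    by (rule back_subst[where P = "\<lambda>X. X \<in> Def_n order_struct 3", OF chain_in_Def_3[of 0 1 2]])
      (auto simp: length_3_conv)
  show "{[x, y, z] | x y z. z < x \<and> y < z} \<in> Def_n order_struct 3"
    by (rule back_subst[where P = "\<lambda>X. X \<in> Def_n order_struct 3", OF chain_in_Def_3[of 1 2 0]])
      (auto simp: length_3_conv)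
  show "{[x, z, y] | x z y. z < x \<and> y < z} \<in> Def_n order_struct 3"
    by (rule back_subst[where P = "\<lambda>X. X \<in> Def_n order_struct 3", OF chain_in_Def_3[of 2 1 0]])
      (auto simp: length_3_conv)
qed

section \<open>The natural numbers and the integers\<close>

lemma not_dimension_function_nat:
  "\<not> dimension_function (order_struct :: (unit, unit, nat) struct) d"
proof
  assume dim: "dimension_function (order_struct :: (unit, unit, nat) struct) d"
  have rays: "d {[y] | y. x < y} = Fin 1" for x
  \<comment> \<open>The universe is both \<open>A\<close> and \<open>C\<close>: in the natural
    numbers the complement \<open>{..x}\<close> of an upper ray is finite.\<close>
  proof (rule dim_one_diff_finite[OF dim UNIV_in_Def_1 rays_in_Def(1) UNIV_in_Def_1])
    show "{xs. length xs = 1} = {[y] | y. x < y} \<union> (\<lambda>a. [a]) ` {..x}"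
      by (auto simp: length_Suc_conv)
  qed (use dim_UNIV[OF dim] in auto)
  have fin: "finite {z. x < z \<and> z < y}" for x y :: nat
    by (rule finite_subset[of _ "{x<..<y}"]) auto
  show False
    by (rule dim_rays_contradiction[OF dim order_in_Def_2(1) intervals_in_Def_3(1,2) _ fin rays])
      simp_all
qed

lemma not_dimension_function_int:
  "\<not> dimension_function (order_struct :: (unit, unit, int) struct) d"
proof
  assume dim: "dimension_function (order_struct :: (unit, unit, int) struct) d"
  \<comment> \<open>These two rays partition the integers, so at least one of them has dimension 1;
    which one is not determined, hence the case split.\<close>
  have "{xs :: int list. length xs = 1} = {[y] | y. 0 < y} \<union> {[y] | y. y < 1}"
    by (auto simp: length_Suc_conv)
  then have "max (d {[y] | y. 0 < y}) (d {[y] | y. y < 1}) = Fin 1"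
    using dim_UNIV[OF dim] dim_Un[OF dim _ rays_in_Def(1) rays_in_Def(2), of 0 1] by simp
  then consider "d {[y] | y. 0 < y} = Fin 1" | "d {[y] | y. y < 1} = Fin 1"
    by (auto simp only: max_def split: if_splits)
  then show False
  proof cases
    case 1
    have rays: "d {[y] | y. x < y} = Fin 1" for x
    proof (rule dim_one_diff_finite[OF dim rays_in_Def(1) rays_in_Def(1) rays_in_Def(1)])
      \<comment> \<open>The ray at \<open>min 0 x\<close> contains the rays at 0 and at
        \<open>x\<close>, whichever is larger, and exceeds the latter by finitely many
        points.\<close>
      show "{[y] | y. min 0 x < y} = {[y] | y. x < y} \<union> (\<lambda>a. [a]) ` {min 0 x<..x}"
        by auto
    qed (use 1 in auto)
    have fin: "finite {z. x < z \<and> z < y}" for x y :: int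
      by (rule finite_subset[of _ "{x<..<y}"]) auto
    show False
      by (rule dim_rays_contradiction[OF dim order_in_Def_2(1) intervals_in_Def_3(1,2) _ fin rays])
        simp_all
  next
    case 2
    have rays: "d {[y] | y. y < x} = Fin 1" for x
    proof (rule dim_one_diff_finite[OF dim rays_in_Def(2) rays_in_Def(2) rays_in_Def(2)])
      \<comment> \<open>Mirror image of the first case, with \<open>max 1 x\<close> bounding a lower
        ray that contains both.\<close>
      show "{[y] | y. y < max 1 x} = {[y] | y. y < x} \<union> (\<lambda>a. [a]) ` {x..<max 1 x}"
        by auto
    qed (use 2 in auto)
    have fin: "finite {z. z < x \<and> y < z}" for x y :: int
      by (rule finite_subset[of _ "{y<..<x}"]) auto
    show False
      by (rule dim_rays_contradiction[OF dim order_in_Def_2(2) intervals_in_Def_3(3,4) _ fin rays])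
        simp_all
  qed
qed

lemma n_dim_eq_czero:
  assumes "\<And>d. \<not> dimension_function M d"
  shows "n_dim M =o (BNF_Cardinal_Arithmetic.czero :: 'b rel)"
  using assms by (simp add: n_dim_def dimension_functions_def card_of_ordIso_czero_iff_empty)

theorem corollary3p4:
  shows "n_dim (order_struct :: (unit, unit, nat) struct) =o (BNF_Cardinal_Arithmetic.czero :: nat rel) \<and>
         n_dim (order_struct :: (unit, unit, int) struct) =o (BNF_Cardinal_Arithmetic.czero :: nat rel) \<and>
         \<not> (\<exists>d. dimension_function (order_struct :: (unit, unit, nat) struct) d) \<and>
         \<not> (\<exists>d. dimension_function (order_struct :: (unit, unit, int) struct) d)"
  by (simp add: n_dim_eq_czero not_dimension_function_nat not_dimension_function_int)

end
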